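(* Let $\alpha\in(0,1)$ and let $\nu := (1+\alpha)^{-1}(\delta_0+\alpha\,\delta_1)$, where $\delta_a$ denotes the Dirac measure at $a\in\mathbb{R}$. Then $\nu$ is admissible and $\Lambda(\nu)=\mathbb{N}$ (that is, $\nu$ is minimally divisible).
   Context: Here $\mathbb{N}=\{1,2,3,\dots\}$. A characteristic function is a function $f:\mathbb{R}\to\mathbb{C}$ that is continuous, positive-definite, and satisfies $f(0)=1$; by Bochner's theorem these are exactly the Fourier transforms $\hat\mu(y)=\int_{\mathbb{R}}e^{iyx}\,\mu(dx)$ of probability measures $\mu$ on $\mathbb{R}$. A probability measure $\mu$ on $\mathbb{R}$ is called admissible if $\hat\mu(y)\neq 0$ for all $y\in\mathbb{R}$. For an admissible $\mu$ there is a unique continuous function $\psi:\mathbb{R}\to\mathbb{C}$ with $\psi(0)=0$ and $\hat\mu=e^{\psi}$, called the second characteristic of $\mu$. For an admissible $\mu$ with second characteristic $\psi$ one sets $\Lambda(\mu):=\{t>0 : e^{t\psi}\text{ is a characteristic function}\}$. An admissible $\mu$ is called minimally divisible if $\Lambda(\mu)=\mathbb{N}$. *)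

theory Defs
  imports "HOL-Probability.Probability"
begin

definition positive_definite :: "(real \<Rightarrow> complex) \<Rightarrow> bool" where
  "positive_definite f \<longleftrightarrow>
     (\<forall>(n::nat) (x::nat \<Rightarrow> real) (c::nat \<Rightarrow> complex).
        let S = (\<Sum>j<n. \<Sum>k<n. c j * cnj (c k) * f (x j - x k))
        in S \<in> \<real> \<and> 0 \<le> Re S)"

definition characteristic_function :: "(real \<Rightarrow> complex) \<Rightarrow> bool" where
  "characteristic_function f \<longleftrightarrow> continuous_on UNIV f \<and> positive_definite f \<and> f 0 = 1"

(* The Fourier transform of a measure M is the library's char M, with the same
   sign convention exp(iyx); real_distribution says that M is a Borel probability
   measure on the real line. *)
definition admissible :: "real measure \<Rightarrow> bool" where
  "admissible M \<longleftrightarrow> real_distribution M \<and> (\<forall>y. char M y \<noteq> 0)"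

definition is_second_characteristic :: "real measure \<Rightarrow> (real \<Rightarrow> complex) \<Rightarrow> bool" where
  "is_second_characteristic M \<psi> \<longleftrightarrow>
     continuous_on UNIV \<psi> \<and> \<psi> 0 = 0 \<and> (\<forall>y. char M y = exp (\<psi> y))"

lemma ex1_second_characteristic:
  assumes "admissible M"
  shows "\<exists>!\<psi>. is_second_characteristic M \<psi>"
proof -
  interpret real_distribution M
    using assms by (simp add: admissible_def)
  have cont: "continuous_on UNIV (char M)"
    by (simp add: continuous_at_imp_continuous_on isCont_char)
  obtain g where g: "continuous_on UNIV g" "\<And>y. char M y = exp (g y)"
    using continuous_logarithm_on_contractible[OF cont] assms
    by (metis UNIV_I admissible_def contractible_UNIV)
  show ?thesis
  proof (rule ex1I)
    show "is_second_characteristic M (\<lambda>y. g y - g 0)"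
      unfolding is_second_characteristic_def
      using g char_zero by (auto intro!: continuous_intros simp: exp_diff)
  next
    fix h assume h: "is_second_characteristic M h"
    define d where "d y = h y - (g y - g 0)" for y
    have "continuous_on UNIV d"
      unfolding d_def using g h
      by (auto intro!: continuous_intros simp: is_second_characteristic_def)
    moreover have exp_d: "exp (d y) = 1" for y
      using g h char_zero by (simp add: d_def exp_diff is_second_characteristic_def)
    have "2 * pi \<le> norm (d z - d y)" if "d z \<noteq> d y" for y z
    proof -
      have "exp (d z) = exp (d y)" by (simp add: exp_d)
      then obtain n :: int where n: "d z = d y + (of_int (2 * n) * pi) * \<i>"
        by (auto simp: exp_eq)
      with that have "n \<noteq> 0" by auto
      then have "1 \<le> \<bar>real_of_int n\<bar>" by linarith
      then show ?thesis
        using n by (simp add: norm_mult)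
    qed
    ultimately have "d constant_on UNIV"
      by (intro continuous_discrete_range_constant[OF connected_UNIV]) (use pi_gt_zero in \<open>auto intro!: exI[of _ "2 * pi"]\<close>)
    then have "d y = d 0" for y
      by (auto simp: constant_on_def)
    moreover have "d 0 = 0"
      using h by (simp add: d_def is_second_characteristic_def)
    ultimately show "h = (\<lambda>y. g y - g 0)"
      by (auto simp: d_def fun_eq_iff)
  qed
qed

definition second_characteristic :: "real measure \<Rightarrow> real \<Rightarrow> complex" where
  "second_characteristic M = (THE \<psi>. is_second_characteristic M \<psi>)"

definition Lambda :: "real measure \<Rightarrow> real set" where
  "Lambda M = {t. 0 < t \<and>
     characteristic_function (\<lambda>y. exp (of_real t * second_characteristic M y))}"

definition minimally_divisible :: "real measure \<Rightarrow> bool" where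
  "minimally_divisible M \<longleftrightarrow> admissible M \<and> Lambda M = real ` {1..}"

(* Measures have no addition in the library, so the linear combination of Dirac
   measures (return borel a) is formed setwise. *)
definition two_point_measure :: "real \<Rightarrow> real measure" where
  "two_point_measure \<alpha> = measure_of UNIV (sets borel)
     (\<lambda>A. ennreal (inverse (1 + \<alpha>)) *
        (emeasure (return borel 0) A + ennreal \<alpha> * emeasure (return borel 1) A))"

end

theory Submission
  imports Defs
begin

text \<open>
  The characteristic function of the two-point measure is
  \<open>(1 + \<alpha> exp(iy)) / (1 + \<alpha>)\<close>. Because \<open>\<alpha> < 1\<close>, its values lie in the open right half-plane,
  so the measure is admissible and its second characteristic \<open>\<psi>\<close> is given by the principal
  logarithm. The binomial series then gives, for every \<open>t > 0\<close>,
  \<open>exp (t \<psi>(y)) = (1 + \<alpha>) powr (-t) * (\<Sum>k. (t gchoose k) \<alpha>^k exp(iky))\<close>,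
  with absolute convergence. An absolutely convergent series of this form with real coefficients is
  positive definite if and only if all its coefficients are nonnegative
  (\<open>positive_definite_trig_seriesI\<close> and \<open>coeff_nonneg_if_positive_definite\<close>). Hence \<open>t\<close> belongs to
  \<open>\<Lambda>\<close> exactly if no binomial coefficient \<open>t gchoose k\<close> is negative, and for \<open>t > 0\<close> this means that
  \<open>t\<close> is a positive integer: if \<open>n < t < n + 1\<close>, then the numerator of \<open>t gchoose (n + 2)\<close> has
  exactly one negative factor, \<open>t - n - 1\<close> (\<open>gbinomial_nonneg_iff\<close>).
\<close>

section \<open>Positive definite trigonometric series\<close>

text \<open>
  The Hermitian form of a trigonometric series is diagonal in the frequencies: the frequency \<open>l\<close>
  contributes its coefficient times the squared modulus of a trigonometric polynomial.
\<close>
lemma hermitian_form_trig_series: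
  fixes b :: "nat \<Rightarrow> real" and f :: "real \<Rightarrow> complex"
  assumes f: "\<And>y. (\<lambda>l. of_real (b l) * cis y ^ l) sums f y"
  defines "q \<equiv> \<lambda>n (x :: nat \<Rightarrow> real) (c :: nat \<Rightarrow> complex) l.
    b l * (cmod (\<Sum>j<n. c j * cis (x j) ^ l))\<^sup>2"
  shows "(\<lambda>l. complex_of_real (q n x c l)) sums
    (\<Sum>j<n. \<Sum>k<n. c j * cnj (c k) * f (x j - x k))"
proof -
  have "(\<lambda>l. \<Sum>j<n. \<Sum>k<n. c j * cnj (c k) * (of_real (b l) * cis (x j - x k) ^ l)) sums
    (\<Sum>j<n. \<Sum>k<n. c j * cnj (c k) * f (x j - x k))"
    by (intro sums_sum sums_mult f)
  moreover have "(\<Sum>j<n. \<Sum>k<n. c j * cnj (c k) * (of_real (b l) * cis (x j - x k) ^ l))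
    = complex_of_real (q n x c l)" for l
  proof -
    have cis_diff: "cis (x j - x k) ^ l = cis (x j) ^ l * cnj (cis (x k) ^ l)" for j k
      by (simp add: cis_cnj cis_mult flip: power_mult_distrib)
    have "complex_of_real (q n x c l) = of_real (b l) *
        ((\<Sum>j<n. c j * cis (x j) ^ l) * cnj (\<Sum>k<n. c k * cis (x k) ^ l))"
      unfolding q_def by (simp only: of_real_mult complex_norm_square)
    also have "\<dots> = (\<Sum>j<n. \<Sum>k<n. c j * cnj (c k) * (of_real (b l) * cis (x j - x k) ^ l))"
      unfolding cis_diff cnj_sum complex_cnj_mult sum_product
      unfolding sum_distrib_left
      by (intro sum.cong) (simp_all add: mult_ac)
    finally show ?thesis by simp
  qed
  ultimately show ?thesis by simp
qed

lemma positive_definite_trig_seriesI: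
  fixes b :: "nat \<Rightarrow> real" and f :: "real \<Rightarrow> complex"
  assumes f: "\<And>y. (\<lambda>l. of_real (b l) * cis y ^ l) sums f y"
    and b: "\<And>l. 0 \<le> b l"
  shows "positive_definite f"
  unfolding positive_definite_def Let_def
proof (intro allI)
  fix n :: nat and x :: "nat \<Rightarrow> real" and c :: "nat \<Rightarrow> complex"
  define S where "S = (\<Sum>j<n. \<Sum>k<n. c j * cnj (c k) * f (x j - x k))"
  define q where "q l = b l * (cmod (\<Sum>j<n. c j * cis (x j) ^ l))\<^sup>2" for l
  have S: "(\<lambda>l. complex_of_real (q l)) sums S"
    unfolding S_def q_def by (rule hermitian_form_trig_series[OF f])
  then have Re: "q sums Re S"
    using sums_Re by fastforce
  then have "S = of_real (Re S)"
    using S sums_of_real sums_unique2 by blast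
  then have "S \<in> \<real>"
    by (metis Reals_of_real)
  moreover have "0 \<le> Re S"
    using Re b by (intro sums_le[OF _ sums_zero Re]) (simp add: q_def)
  ultimately show "S \<in> \<real> \<and> 0 \<le> Re S" by simp
qed

lemma sum_roots_of_unity_orthogonal:
  fixes N l m :: nat
  assumes "l < N" "m < N" "l \<noteq> m"
  shows "(\<Sum>j<N. cnj (cis (2 * pi * j / N)) ^ m * cis (2 * pi * j / N) ^ l) = 0"
proof -
  define e where "e k = cis (2 * pi * real k / real N)" for k :: nat
  have e_exp: "e k = exp (2 * of_real pi * \<i> * of_nat k / of_nat N)" for k
    by (simp add: e_def cis_conv_exp mult_ac)
  have eN: "e k ^ N = 1" for k
    using assms complex_root_unity[of N k] unfolding e_exp by simp
  have swap: "cis (2 * pi * real j / real N) ^ k = e k ^ j" for j k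
    unfolding e_def Complex.DeMoivre by (rule arg_cong[of _ _ cis]) (simp add: mult_ac)
  define w where "w = cnj (e m) * e l"
  have "e l \<noteq> e m"
    using assms complex_root_unity_eq[of N l m] unfolding e_exp by (simp add: cong_def)
  moreover have "e m * w = e l"
    using complex_norm_square[of "e m"] by (simp add: w_def flip: mult.assoc) (simp add: e_def)
  ultimately have "w \<noteq> 1" by auto
  moreover have "w ^ N = 1"
    by (simp add: w_def power_mult_distrib eN flip: complex_cnj_power)
  ultimately have "(\<Sum>j<N. w ^ j) = 0"
    by (simp add: sum_gp_strict)
  then show ?thesis
    by (simp add: w_def power_mult_distrib swap flip: complex_cnj_power)
qed

text \<open>
  The converse tests positive definiteness on the \<open>N\<close>-th roots of unity with the weights of the
  character of frequency \<open>-m\<close>. By orthogonality the form is \<open>N\<^sup>2\<close> times \<open>b m\<close>, up to an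
  error from the frequencies \<open>l \<ge> N\<close>, which for large \<open>N\<close> is too small to outweigh a
  negative \<open>b m\<close>.
\<close>
lemma coeff_nonneg_if_positive_definite:
  fixes b :: "nat \<Rightarrow> real" and f :: "real \<Rightarrow> complex"
  assumes f: "\<And>y. (\<lambda>l. of_real (b l) * cis y ^ l) sums f y"
    and b: "summable (\<lambda>l. \<bar>b l\<bar>)"
    and pd: "positive_definite f"
  shows "0 \<le> b m"
proof (rule ccontr)
  assume "\<not> 0 \<le> b m"
  then have "0 < - b m" by simp
  then obtain N0 where N0: "\<And>N. N \<ge> N0 \<Longrightarrow> norm (\<Sum>l. \<bar>b (l + N)\<bar>) < - b m"
    using suminf_exist_split[OF _ b] by metis
  define N where "N = max N0 (Suc m)"
  have mN: "m < N" and tail: "(\<Sum>l. \<bar>b (l + N)\<bar>) < - b m"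
    using N0[of N] by (auto simp: N_def)
  define x where "x j = 2 * pi * real j / real N" for j :: nat
  define c where "c j = cnj (cis (x j)) ^ m" for j :: nat
  define D where "D l = (\<Sum>j<N. c j * cis (x j) ^ l)" for l
  define q where "q l = b l * (cmod (D l))\<^sup>2" for l
  define S where "S = (\<Sum>j<N. \<Sum>k<N. c j * cnj (c k) * f (x j - x k))"
  have "(\<lambda>l. complex_of_real (q l)) sums S"
    unfolding S_def q_def D_def by (rule hermitian_form_trig_series[OF f])
  then have q: "q sums Re S"
    using sums_Re by fastforce
  have "0 \<le> Re S"
    using pd unfolding positive_definite_def Let_def S_def by blast
  have D_m: "D m = of_nat N"
    by (simp add: D_def c_def cis_cnj cis_mult flip: power_mult_distrib)
  have D_0: "D l = 0" if "l < N" "l \<noteq> m" for l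
    using sum_roots_of_unity_orthogonal[OF that(1) mN that(2)] by (simp add: D_def c_def x_def)
  have D_le: "cmod (D l) \<le> real N" for l
  proof -
    have "cmod (D l) \<le> (\<Sum>j<N. cmod (c j * cis (x j) ^ l))"
      unfolding D_def by (rule norm_sum)
    then show ?thesis by (simp add: c_def norm_mult norm_power)
  qed
  have tail_summable: "summable (\<lambda>l. \<bar>b (l + N)\<bar>)"
    using summable_ignore_initial_segment[OF b] by simp
  have "(\<Sum>l<N. q l) = (\<Sum>l<N. if l = m then b m * (real N)\<^sup>2 else 0)"
    by (intro sum.cong) (auto simp: q_def D_m D_0)
  then have head: "(\<Sum>l<N. q l) = b m * (real N)\<^sup>2"
    using mN by simp
  have "(\<Sum>l. q (l + N)) \<le> (\<Sum>l. \<bar>b (l + N)\<bar> * (real N)\<^sup>2)"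
  proof (rule suminf_le)
    show "q (l + N) \<le> \<bar>b (l + N)\<bar> * (real N)\<^sup>2" for l
      unfolding q_def using D_le[of "l + N"] by (intro mult_mono power_mono) auto
    show "summable (\<lambda>l. q (l + N))"
      using q summable_ignore_initial_segment sums_summable by blast
    show "summable (\<lambda>l. \<bar>b (l + N)\<bar> * (real N)\<^sup>2)"
      by (intro summable_mult2 tail_summable)
  qed
  also have "\<dots> = (\<Sum>l. \<bar>b (l + N)\<bar>) * (real N)\<^sup>2"
    using suminf_mult2[OF tail_summable] by simp
  also have "\<dots> < - b m * (real N)\<^sup>2"
    using tail mN by (intro mult_strict_right_mono) auto
  finally have "(\<Sum>l. q (l + N)) + (\<Sum>l<N. q l) < 0"
    using head by simp
  then have "Re S < 0"
    using q suminf_split_initial_segment[of q N] sums_summable sums_unique by fastforce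
  with \<open>0 \<le> Re S\<close> show False by simp
qed

section \<open>Signs of the binomial coefficients\<close>

lemma gbinomial_nonneg_iff:
  fixes t :: real
  assumes "0 < t"
  shows "(\<forall>k. 0 \<le> t gchoose k) \<longleftrightarrow> t \<in> real ` {1..}"
proof
  assume nonneg: "\<forall>k. 0 \<le> t gchoose k"
  show "t \<in> real ` {1..}"
  proof (rule ccontr)
    assume nonint: "t \<notin> real ` {1..}"
    define n where "n = nat \<lfloor>t\<rfloor>"
    have n: "real n \<le> t" "t < real n + 1"
      using assms by (auto simp: n_def)
    moreover have "t \<noteq> real n"
    proof
      assume "t = real n"
      moreover from this assms have "n \<in> {1..}" by simp
      ultimately show False using nonint by blast
    qed
    ultimately have "real n < t" by simp
    \<comment> \<open>The factors \<open>t - i\<close> are positive for \<open>i \<le> n\<close> and negative for \<open>i = n + 1\<close>.\<close>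
    then have "0 < (\<Prod>i = 0..<Suc n. t - real i)"
      by (intro prod_pos) auto
    then have "(\<Prod>i = 0..<Suc (Suc n). t - real i) < 0"
      using n by (subst prod.atLeast0_lessThan_Suc) (simp add: mult_pos_neg)
    then have "t gchoose Suc (Suc n) < 0"
      unfolding gbinomial_prod_rev by (intro divide_neg_pos) simp_all
    with nonneg show False by (meson not_le)
  qed
next
  assume "t \<in> real ` {1..}"
  then show "\<forall>k. 0 \<le> t gchoose k"
    by (auto simp flip: binomial_gbinomial)
qed

lemma of_real_gbinomial:
  "(of_real a :: 'a :: real_normed_field) gchoose k = of_real (a gchoose k)"
  by (simp add: gbinomial_prod_rev)

lemma summable_abs_gbinomial_series:
  fixes t z :: real
  assumes "\<bar>z\<bar> < 1"
  shows "summable (\<lambda>k. \<bar>(t gchoose k) * z ^ k\<bar>)"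
proof -
  \<comment> \<open>Convergence at some \<open>r\<close> beyond \<open>\<bar>z\<bar>\<close> forces absolute convergence at \<open>z\<close>.\<close>
  obtain r where r: "\<bar>z\<bar> < r" "r < 1"
    using dense assms by blast
  then have "summable (\<lambda>k. (t gchoose k) * r ^ k)"
    using gen_binomial_real[of r t] sums_summable by auto
  then show ?thesis
    using powser_insidea[of "\<lambda>k. t gchoose k" r z] r by simp
qed

section \<open>The two-point measure\<close>

text \<open>
  The set function in the definition of the two-point measure agrees on Borel sets with the law
  of a Bernoulli variable. This identification supplies countable additivity, without which
  \<open>measure_of\<close> would yield the zero measure.
\<close>
lemma two_point_measure_eq_distr:
  fixes \<alpha> :: real
  assumes "0 < \<alpha>"
  shows "two_point_measure \<alpha> =
    distr (measure_pmf (bernoulli_pmf (\<alpha> / (1 + \<alpha>)))) borel of_bool"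
    (is "_ = ?D")
proof -
  have p: "0 \<le> \<alpha> / (1 + \<alpha>)" "\<alpha> / (1 + \<alpha>) \<le> 1"
    using assms by auto
  have "emeasure ?D A = ennreal (inverse (1 + \<alpha>)) *
      (emeasure (return borel 0) A + ennreal \<alpha> * emeasure (return borel 1) A)"
    if A: "A \<in> sets borel" for A
  proof -
    have "emeasure ?D A = (\<integral>\<^sup>+ x. indicator A x \<partial>?D)"
      using A by simp
    also have "\<dots> = (\<integral>\<^sup>+ b. indicator A (of_bool b) \<partial>bernoulli_pmf (\<alpha> / (1 + \<alpha>)))"
      using A by (intro nn_integral_distr) auto
    also have "\<dots> = indicator A 1 * ennreal (\<alpha> / (1 + \<alpha>)) +
        indicator A 0 * ennreal (1 - \<alpha> / (1 + \<alpha>))"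
      using p by (subst nn_integral_bernoulli_pmf) auto
    also have "1 - \<alpha> / (1 + \<alpha>) = inverse (1 + \<alpha>)"
      using assms by (simp add: field_simps)
    also have "ennreal (\<alpha> / (1 + \<alpha>)) = ennreal (inverse (1 + \<alpha>)) * ennreal \<alpha>"
      using assms by (simp add: divide_inverse mult.commute flip: ennreal_mult)
    finally show ?thesis
      using A by (simp add: emeasure_return algebra_simps)
  qed
  then have "two_point_measure \<alpha> = measure_of UNIV (sets borel) (emeasure ?D)"
    unfolding two_point_measure_def
    by (intro measure_of_eq) (auto simp: sets.sigma_sets_eq[of borel, simplified])
  also have "\<dots> = ?D"
    using measure_of_of_measure[of ?D] by simp
  finally show ?thesis .
qed

lemma real_distribution_two_point_measure:
  assumes "0 < \<alpha>"
  shows "real_distribution (two_point_measure \<alpha>)"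
  unfolding two_point_measure_eq_distr[OF assms]
  by (intro prob_space.real_distribution_distr measure_pmf.prob_space_axioms) simp

lemma char_two_point_measure:
  assumes "0 < \<alpha>"
  shows "char (two_point_measure \<alpha>) y = (1 + of_real \<alpha> * cis y) / of_real (1 + \<alpha>)"
proof -
  have "char (two_point_measure \<alpha>) y =
      (CLINT b|bernoulli_pmf (\<alpha> / (1 + \<alpha>)). iexp (y * of_bool b))"
    unfolding two_point_measure_eq_distr[OF assms] char_def by (subst integral_distr) auto
  also have "\<dots> = of_real (\<alpha> / (1 + \<alpha>)) * cis y + of_real (1 - \<alpha> / (1 + \<alpha>))"
    using assms by (subst integral_measure_pmf[of UNIV])
      (auto simp: UNIV_bool cis_conv_exp scaleR_conv_of_real)
  also have "\<dots> = (1 + of_real \<alpha> * cis y) / of_real (1 + \<alpha>)"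
  proof -
    have "1 - \<alpha> / (1 + \<alpha>) = 1 / (1 + \<alpha>)"
      using assms by (simp add: field_simps)
    then show ?thesis by (simp add: add_divide_distrib)
  qed
  finally show ?thesis .
qed

lemma Re_one_plus_cis_pos:
  fixes \<alpha> :: real
  assumes "0 < \<alpha>" "\<alpha> < 1"
  shows "0 < Re (1 + of_real \<alpha> * cis y)"
proof -
  have "\<alpha> * (- cos y) \<le> \<alpha>"
    using assms cos_ge_minus_one[of y] by (intro mult_left_le) auto
  then show ?thesis using assms by simp
qed

lemma admissible_two_point_measure:
  assumes "0 < \<alpha>" "\<alpha> < 1"
  shows "admissible (two_point_measure \<alpha>)"
proof -
  have "1 + of_real \<alpha> * cis y \<noteq> 0" for y
    using Re_one_plus_cis_pos[OF assms, of y] by (metis less_irrefl zero_complex.sel(1))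
  moreover have "complex_of_real (1 + \<alpha>) \<noteq> 0"
    using assms by (simp only: of_real_eq_0_iff)
  ultimately show ?thesis
    using real_distribution_two_point_measure assms
    by (simp only: admissible_def char_two_point_measure divide_eq_0_iff) auto
qed

lemma second_characteristic_two_point_measure:
  assumes "0 < \<alpha>" "\<alpha> < 1"
  shows "second_characteristic (two_point_measure \<alpha>) =
    (\<lambda>y. Ln (1 + of_real \<alpha> * cis y) - of_real (ln (1 + \<alpha>)))"
    (is "_ = ?\<psi>")
proof -
  have nz: "1 + of_real \<alpha> * cis y \<noteq> 0" for y
    using Re_one_plus_cis_pos[OF assms, of y] by (metis less_irrefl zero_complex.sel(1))
  have "1 + of_real \<alpha> * cis y \<notin> \<real>\<^sub>\<le>\<^sub>0" for y
    using Re_one_plus_cis_pos[OF assms, of y] complex_nonpos_Reals_iff not_le by blast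
  then have "continuous_on UNIV ?\<psi>"
    by (intro continuous_intros) auto
  moreover have "?\<psi> 0 = 0"
    using assms Ln_of_real[of "1 + \<alpha>"] by simp
  moreover have "char (two_point_measure \<alpha>) y = exp (?\<psi> y)" for y
    using assms by (simp only: char_two_point_measure exp_diff exp_Ln[OF nz] exp_of_real exp_ln add_pos_pos zero_less_one)
  ultimately have "is_second_characteristic (two_point_measure \<alpha>) ?\<psi>"
    by (simp add: is_second_characteristic_def)
  then show ?thesis
    unfolding second_characteristic_def
    using ex1_second_characteristic[OF admissible_two_point_measure[OF assms]]
    by (rule the1_equality[rotated])
qed

lemma exp_second_characteristic_two_point_measure_sums:
  fixes \<alpha> t :: real
  assumes "0 < \<alpha>" "\<alpha> < 1"
  shows "(\<lambda>k. of_real ((1 + \<alpha>) powr (- t) * ((t gchoose k) * \<alpha> ^ k)) * cis y ^ k) sums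
    exp (of_real t * second_characteristic (two_point_measure \<alpha>) y)"
proof -
  define z where "z = of_real \<alpha> * cis y"
  have nz: "1 + z \<noteq> 0"
    using Re_one_plus_cis_pos[OF assms, of y] unfolding z_def
    by (metis less_irrefl zero_complex.sel(1))
  have "cmod z < 1"
    using assms by (simp add: z_def norm_mult)
  then have "(\<lambda>k. of_real ((1 + \<alpha>) powr (- t)) * ((of_real t gchoose k) * z ^ k)) sums
      (of_real ((1 + \<alpha>) powr (- t)) * (1 + z) powr of_real t)"
    by (intro sums_mult gen_binomial_complex)
  moreover have "of_real ((1 + \<alpha>) powr (- t)) * (1 + z) powr of_real t =
      exp (of_real t * second_characteristic (two_point_measure \<alpha>) y)"
  proof -
    have "complex_of_real ((1 + \<alpha>) powr (- t)) = exp (of_real (- t * ln (1 + \<alpha>)))"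
      unfolding powr_def exp_of_real using assms by simp
    moreover have "(1 + z) powr of_real t = exp (of_real t * Ln (1 + z))"
      using nz by (simp add: powr_def)
    ultimately have "of_real ((1 + \<alpha>) powr (- t)) * (1 + z) powr of_real t =
        exp (of_real (- t * ln (1 + \<alpha>)) + of_real t * Ln (1 + z))"
      by (simp only: exp_add)
    also have "of_real (- t * ln (1 + \<alpha>)) + of_real t * Ln (1 + z) =
        of_real t * second_characteristic (two_point_measure \<alpha>) y"
      unfolding second_characteristic_two_point_measure[OF assms] z_def
      by (simp add: right_diff_distrib)
    finally show ?thesis .
  qed
  moreover have "of_real ((1 + \<alpha>) powr (- t)) * ((of_real t gchoose k) * z ^ k) =
      of_real ((1 + \<alpha>) powr (- t) * ((t gchoose k) * \<alpha> ^ k)) * cis y ^ k" for k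
    by (simp add: z_def of_real_gbinomial power_mult_distrib)
  ultimately show ?thesis by simp
qed

lemma mem_Lambda_two_point_measure_iff:
  fixes \<alpha> t :: real
  assumes "0 < \<alpha>" "\<alpha> < 1" "0 < t"
  shows "t \<in> Lambda (two_point_measure \<alpha>) \<longleftrightarrow> (\<forall>k. 0 \<le> t gchoose k)"
proof -
  define f where "f y = exp (of_real t * second_characteristic (two_point_measure \<alpha>) y)" for y
  define b where "b k = (1 + \<alpha>) powr (- t) * ((t gchoose k) * \<alpha> ^ k)" for k
  have f: "(\<lambda>k. of_real (b k) * cis y ^ k) sums f y" for y
    unfolding f_def b_def by (rule exp_second_characteristic_two_point_measure_sums[OF assms(1,2)])
  have b: "summable (\<lambda>k. \<bar>b k\<bar>)"
    using summable_mult[OF summable_abs_gbinomial_series[of \<alpha> t], of "(1 + \<alpha>) powr (- t)"] assms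
    by (simp add: b_def abs_mult)
  have sign: "0 \<le> b k \<longleftrightarrow> 0 \<le> t gchoose k" for k
  proof -
    define p where "p = (1 + \<alpha>) powr (- t) * \<alpha> ^ k"
    have "b k = p * (t gchoose k)"
      by (simp add: b_def p_def)
    moreover have "0 < p"
      using assms by (simp add: p_def)
    ultimately show ?thesis
      by (simp add: zero_le_mult_iff)
  qed
  have "is_second_characteristic (two_point_measure \<alpha>)
      (second_characteristic (two_point_measure \<alpha>))"
    unfolding second_characteristic_def
    by (rule theI'[OF ex1_second_characteristic[OF admissible_two_point_measure[OF assms(1,2)]]])
  then have cont: "continuous_on UNIV (second_characteristic (two_point_measure \<alpha>))"
    and zero: "second_characteristic (two_point_measure \<alpha>) 0 = 0"
    unfolding is_second_characteristic_def by blast+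
  have "continuous_on UNIV f"
    unfolding f_def by (intro continuous_intros cont)
  moreover have "f 0 = 1"
    unfolding f_def zero by simp
  moreover have "t \<in> Lambda (two_point_measure \<alpha>) \<longleftrightarrow> characteristic_function f"
    using assms by (simp only: Lambda_def f_def[abs_def] mem_Collect_eq simp_thms)
  ultimately have "t \<in> Lambda (two_point_measure \<alpha>) \<longleftrightarrow> positive_definite f"
    by (simp only: characteristic_function_def simp_thms)
  also have "\<dots> \<longleftrightarrow> (\<forall>k. 0 \<le> b k)"
  proof
    show "\<forall>k. 0 \<le> b k" if "positive_definite f"
      using coeff_nonneg_if_positive_definite[OF f b that] by (rule allI)
    show "positive_definite f" if "\<forall>k. 0 \<le> b k"
      by (rule positive_definite_trig_seriesI[OF f that[rule_format]])
  qed
  finally show ?thesis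
    by (simp add: sign)
qed

theorem mainTheorem1:
  fixes \<alpha> :: real
  assumes "0 < \<alpha>" and "\<alpha> < 1"
  shows "admissible (two_point_measure \<alpha>) \<and>
         Lambda (two_point_measure \<alpha>) = real ` {1..} \<and>
         minimally_divisible (two_point_measure \<alpha>)"
proof -
  have "t \<in> Lambda (two_point_measure \<alpha>) \<longleftrightarrow> t \<in> real ` {1..}" for t
  proof (cases "0 < t")
    case True
    then show ?thesis
      using mem_Lambda_two_point_measure_iff[OF assms True] gbinomial_nonneg_iff[OF True] by argo
  next
    case False
    then show ?thesis by (auto simp: Lambda_def)
  qed
  then have "Lambda (two_point_measure \<alpha>) = real ` {1..}"
    by (rule set_eqI)
  then show ?thesis
    using admissible_two_point_measure[OF assms] by (simp add: minimally_divisible_def)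
qed

end
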